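(* Let $f:\mathbb{R}^d\to\mathbb{R}$ be differentiable, and let $\nabla f(x;\xi)$ be a stochastic gradient that is unbiased, i.e. $\mathbb{E}[\nabla f(x;\xi)\mid x]=\nabla f(x)$ for every $x\in\mathbb{R}^d$. Suppose there is a constant $\sigma_g\ge0$ such that $\|\nabla f(x;\xi)-\nabla f(x)\|\le\sigma_g$ almost surely for every $x\in\mathbb{R}^d$. Let $q>0$ and define $\Psi_q(r):=\min\{r^2,qr\}$ for $r\ge0$. Then, for every $x\in\mathbb{R}^d$, $$\big\langle\nabla f(x),\,\mathbb{E}[\mathrm{clip}_q(\nabla f(x;\xi))\mid x]\big\rangle\ \ge\ \|\nabla f(x)\|^2-\|\nabla f(x)\|\,\big(\|\nabla f(x)\|+\sigma_g-q\big)_+.$$ In particular, if $q>\sigma_g$, then for every $x\in\mathbb{R}^d$, $$\big\langle\nabla f(x),\,\mathbb{E}[\mathrm{clip}_q(\nabla f(x;\xi))\mid x]\big\rangle\ \ge\ \Big(1-\frac{\sigma_g}{q}\Big)\Psi_q(\|\nabla f(x)\|).$$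
   Context: $\|\cdot\|$ is the Euclidean norm on $\mathbb{R}^d$ and $(a)_+:=\max\{a,0\}$. For $q>0$ and $v\in\mathbb{R}^d$, $\mathrm{clip}_q(v):=\min(1,q/\|v\|)\,v$ (with $\mathrm{clip}_q(0)=0$). $\nabla f(x;\xi)$ is, for each $x$, a random vector depending on the random sample $\xi$; $\mathbb{E}[\,\cdot\mid x]$ denotes expectation over $\xi$ with the point $x$ held fixed. *)

theory Defs
  imports "HOL-Probability.Probability"
begin

definition grad :: "(real ^ 'n \<Rightarrow> real) \<Rightarrow> real ^ 'n \<Rightarrow> real ^ 'n" where
  "grad f x = (THE g. GDERIV f x :> g)"

lemma GDERIV_grad:
  fixes f :: "real ^ 'n \<Rightarrow> real"
  assumes "f differentiable (at x)"
  shows "GDERIV f x :> grad f x"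
proof -
  obtain f' where f': "(f has_derivative f') (at x)"
    using assms by (auto simp: differentiable_def)
  have "linear f'"
    using f' by (rule has_derivative_linear)
  have "f' h = h \<bullet> adjoint f' 1" for h
    using adjoint_works[OF \<open>linear f'\<close>, of h 1] by (simp only: inner_real_def mult_1_right)
  then have "f' = (\<lambda>h. h \<bullet> adjoint f' 1)"
    by (rule ext)
  with f' have ex: "GDERIV f x :> adjoint f' 1"
    unfolding gderiv_def by (rule back_subst)
  show ?thesis
    unfolding grad_def
  proof (rule theI[of "\<lambda>g. GDERIV f x :> g", OF ex])
    fix g assume "GDERIV f x :> g"
    then have "(\<lambda>h. h \<bullet> g) = (\<lambda>h. h \<bullet> adjoint f' 1)"
      using ex unfolding gderiv_def by (rule has_derivative_unique)
    then show "g = adjoint f' 1"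
      by (simp only: fun_eq_iff vector_eq_ldot)
  qed
qed

(* Since q / 0 = 0, this gives clip q 0 = 0. *)
definition clip :: "real \<Rightarrow> real ^ 'n \<Rightarrow> real ^ 'n" where
  "clip q v = min 1 (q / norm v) *\<^sub>R v"

definition Psi :: "real \<Rightarrow> real \<Rightarrow> real" where
  "Psi q r = min (r\<^sup>2) (q * r)"

end

(* Clipping displaces v by (||v|| - q)_+, which is at most (||grad f x|| + sigma - q)_+ almost
   surely; Cauchy-Schwarz bounds the loss in the inner product pointwise, and unbiasedness turns
   the expectation of the unclipped part into ||grad f x||^2. *)
theory Submission
  imports Defs
begin

lemma borel_measurable_clip [measurable]: "clip q \<in> borel_measurable borel"
  unfolding clip_def[abs_def] by measurable

lemma norm_clip_le:
  assumes "q \<ge> 0"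
  shows "norm (clip q v) \<le> norm v"
proof -
  have "\<bar>min 1 (q / norm v)\<bar> \<le> 1"
    using assms by (simp add: min_def)
  then have "\<bar>min 1 (q / norm v)\<bar> * norm v \<le> 1 * norm v"
    by (rule mult_right_mono) simp
  then show ?thesis
    by (simp add: clip_def)
qed

text \<open>Clipping never lengthens a vector, so \<open>X\<close> itself is an integrable
  dominating function.\<close>

lemma integrable_clip:
  assumes "q \<ge> 0" and "integrable M X"
  shows "integrable M (\<lambda>\<omega>. clip q (X \<omega>))"
proof (rule Bochner_Integration.integrable_bound[OF assms(2)])
  show "(\<lambda>\<omega>. clip q (X \<omega>)) \<in> borel_measurable M"
    using assms(2) by measurable
  show "AE \<omega> in M. norm (clip q (X \<omega>)) \<le> norm (X \<omega>)"
    using assms(1) by (intro AE_I2 norm_clip_le)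
qed

text \<open>Clipping is the radial projection onto the ball of radius \<open>q\<close>, so the
  displacement is the distance from \<open>v\<close> to that ball.\<close>

lemma norm_diff_clip:
  assumes "q \<ge> 0"
  shows "norm (v - clip q v) = max (norm v - q) 0"
proof (cases "norm v \<le> q")
  case True
  then have "clip q v = v"
    \<comment> \<open>At \<open>v = 0\<close> the scaling factor is 0 rather than 1, because
      \<open>q / 0 = 0\<close>; the clipped vector is still \<open>v\<close>.\<close>
    by (cases "v = 0") (simp_all add: clip_def field_simps)
  then show ?thesis
    using True by simp
next
  case False
  then have "norm v > 0"
    using assms by linarith
  with False have le: "q / norm v \<le> 1"
    by (simp add: field_simps)
  then have "v - clip q v = (1 - q / norm v) *\<^sub>R v"
    by (simp add: clip_def algebra_simps)
  then have "norm (v - clip q v) = (1 - q / norm v) * norm v"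
    using le by simp
  also have "\<dots> = norm v - q"
    using \<open>norm v > 0\<close> by (simp add: field_simps)
  finally show ?thesis
    using False by simp
qed

text \<open>The term \<open>m \<bullet> v\<close> is kept exact and only the displacement is
  estimated, so the lower bound is affine in \<open>v\<close> and the loss does not depend on
  \<open>v\<close>.\<close>

lemma inner_clip_ge:
  assumes "q \<ge> 0" and "norm (v - m) \<le> \<sigma>"
  shows "m \<bullet> clip q v \<ge> m \<bullet> v - norm m * max (norm m + \<sigma> - q) 0"
proof -
  have "norm v \<le> norm m + \<sigma>"
    using norm_triangle_sub[of v m] assms(2) by linarith
  then have "norm (v - clip q v) \<le> max (norm m + \<sigma> - q) 0"
    by (auto simp: norm_diff_clip[OF assms(1)])
  then have "m \<bullet> (v - clip q v) \<le> norm m * max (norm m + \<sigma> - q) 0"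
    using norm_cauchy_schwarz[of m "v - clip q v"]
    by (meson mult_left_mono norm_ge_zero order_trans)
  then show ?thesis
    by (simp add: inner_diff_right)
qed

text \<open>The pointwise lower bound is affine in \<open>X\<close>, so its expectation depends on
  \<open>X\<close> only through the mean \<open>m\<close>. The stochastic gradient at a fixed point
  is an instance.\<close>

lemma (in prob_space) inner_expectation_clip_ge:
  fixes X :: "'a \<Rightarrow> real ^ 'n"
  assumes "q \<ge> 0" and "integrable M X" and "expectation X = m"
    and "AE \<omega> in M. norm (X \<omega> - m) \<le> \<sigma>"
  shows "m \<bullet> expectation (\<lambda>\<omega>. clip q (X \<omega>))
           \<ge> (norm m)\<^sup>2 - norm m * max (norm m + \<sigma> - q) 0"
proof -
  let ?c = "norm m * max (norm m + \<sigma> - q) 0"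
  have "(norm m)\<^sup>2 - ?c = expectation (\<lambda>\<omega>. m \<bullet> X \<omega> - ?c)"
    using assms(2,3) by (simp add: prob_space power2_norm_eq_inner)
  also have "\<dots> \<le> expectation (\<lambda>\<omega>. m \<bullet> clip q (X \<omega>))"
  proof (rule integral_mono_AE)
    show "AE \<omega> in M. m \<bullet> X \<omega> - ?c \<le> m \<bullet> clip q (X \<omega>)"
      using assms(4) by eventually_elim (rule inner_clip_ge[OF assms(1)])
  qed (use assms(2) integrable_clip[OF assms(1,2)] in auto)
  also have "\<dots> = m \<bullet> expectation (\<lambda>\<omega>. clip q (X \<omega>))"
    using integrable_clip[OF assms(1,2)] by simp
  finally show ?thesis .
qed

text \<open>Both branches of the minimum bound \<open>Psi q r\<close> from above for every
  \<open>r\<close>, so the cases can split where the positive part vanishes, at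
  \<open>r + \<sigma> = q\<close>, instead of at \<open>r = q\<close>, where \<open>Psi\<close>
  changes branch.\<close>

lemma Psi_le:
  assumes "r \<ge> 0" and "\<sigma> \<ge> 0" and "\<sigma> < q"
  shows "(1 - \<sigma> / q) * Psi q r \<le> r\<^sup>2 - r * max (r + \<sigma> - q) 0"
proof -
  have factor: "0 \<le> 1 - \<sigma> / q" "1 - \<sigma> / q \<le> 1"
    using assms by (simp_all add: field_simps)
  show ?thesis
  proof (cases "r + \<sigma> \<le> q")
    case True
    have "(1 - \<sigma> / q) * Psi q r \<le> (1 - \<sigma> / q) * r\<^sup>2"
      using factor(1) by (intro mult_left_mono) (simp_all add: Psi_def)
    also have "\<dots> \<le> r\<^sup>2"
      using factor by (intro mult_left_le_one_le) simp_all
    finally show ?thesis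
      using True by simp
  next
    case False
    have "(1 - \<sigma> / q) * Psi q r \<le> (1 - \<sigma> / q) * (q * r)"
      using factor(1) by (intro mult_left_mono) (simp_all add: Psi_def)
    \<comment> \<open>Both sides equal \<open>(q - \<sigma>) * r\<close>, so the factor
      \<open>1 - \<sigma> / q\<close> is exactly what the linear branch allows.\<close>
    also have "\<dots> = r\<^sup>2 - r * (r + \<sigma> - q)"
      using assms by (simp add: field_simps power2_eq_square)
    finally show ?thesis
      using False by simp
  qed
qed

theorem proposition2:
  fixes f :: "real ^ 'n \<Rightarrow> real"
    and M :: "'w measure"
    and G :: "real ^ 'n \<Rightarrow> 'w \<Rightarrow> real ^ 'n"
    and \<sigma> q :: real
  assumes "prob_space M"
    and "\<And>x. f differentiable (at x)"
    and "\<And>x. G x \<in> borel_measurable M"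
    and "\<And>x. integrable M (G x)"
    and "\<And>x. (\<integral>\<xi>. G x \<xi> \<partial>M) = grad f x"
    and "\<sigma> \<ge> 0"
    and "\<And>x. AE \<xi> in M. norm (G x \<xi> - grad f x) \<le> \<sigma>"
    and "q > 0"
  shows "(\<forall>x. grad f x \<bullet> (\<integral>\<xi>. clip q (G x \<xi>) \<partial>M)
              \<ge> (norm (grad f x))\<^sup>2 - norm (grad f x) * max (norm (grad f x) + \<sigma> - q) 0)
       \<and> (q > \<sigma> \<longrightarrow>
            (\<forall>x. grad f x \<bullet> (\<integral>\<xi>. clip q (G x \<xi>) \<partial>M)
                \<ge> (1 - \<sigma> / q) * Psi q (norm (grad f x))))"
proof -
  interpret prob_space M by fact
  have lower: "grad f x \<bullet> (\<integral>\<xi>. clip q (G x \<xi>) \<partial>M)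
      \<ge> (norm (grad f x))\<^sup>2 - norm (grad f x) * max (norm (grad f x) + \<sigma> - q) 0" for x
    using assms(4,5,7,8) by (intro inner_expectation_clip_ge) auto
  moreover have "(1 - \<sigma> / q) * Psi q (norm (grad f x)) \<le> grad f x \<bullet> (\<integral>\<xi>. clip q (G x \<xi>) \<partial>M)"
    if "q > \<sigma>" for x
    using Psi_le[OF norm_ge_zero assms(6) that] lower by (rule order_trans)
  ultimately show ?thesis
    by blast
qed

end
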